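(* Let $\mathcal{A}$ be any fully dependent (i.e. arbitrary) graph generative model on $n$ nodes with overlap $\mathrm{Ov}(\mathcal{A})$. For $\bm{A}$ drawn from $\mathcal{A}$, let $\Delta(\bm{A})$ be the number of triangles in the graph with adjacency matrix $\bm{A}$. Then $$\mathbb{E}[\Delta(\bm{A})] \le \frac{1}{2}n^3\cdot \mathrm{Ov}(\mathcal{A}) .$$
   Context: All graphs are undirected, unweighted, node-labeled, on the vertex set $[n]=\{1,\dots,n\}$, without self-loops; a graph is identified with its symmetric adjacency matrix in $\{0,1\}^{n\times n}$ (zero diagonal). A fully dependent graph generative model is any probability distribution $\mathcal{A}$ over such adjacency matrices. Volume: $\mathrm{Vol}(\mathcal{A}) := \mathbb{E}_{\bm{A}\sim\mathcal{A}}\big[\sum_{i<j}\bm{A}_{ij}\big]$. Overlap: $\mathrm{Ov}(\mathcal{A}) := \dfrac{\mathbb{E}_{\bm{A},\bm{A}'\sim\mathcal{A}}\big[\sum_{i<j}\bm{A}_{ij}\bm{A}'_{ij}\big]}{\mathrm{Vol}(\mathcal{A})}$, where $\bm{A},\bm{A}'$ are two independent samples from $\mathcal{A}$ (defined when $\mathrm{Vol}(\mathcal{A})>0$, which is assumed). A triangle is an unordered set of three distinct, pairwise adjacent nodes. *)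

theory Defs
  imports "HOL-Probability.Probability_Mass_Function" "Jordan_Normal_Form.Matrix"
begin

text \<open>
  Matrix indices start at 0, so the vertex set \<open>[n]\<close> is represented by \<open>{0..<n}\<close>.
  Entries are real so that edge counts need no coercions.
\<close>

definition adjacency_mats :: "nat \<Rightarrow> real mat set" where
  "adjacency_mats n = {A \<in> carrier_mat n n.
     elements_mat A \<subseteq> {0, 1} \<and> transpose_mat A = A \<and> (\<forall>i<n. A $$ (i, i) = 0)}"

text \<open>As \<open>adjacency_mats n\<close> is finite, probability mass functions supported in it are exactly the
  probability distributions on it.\<close>

definition graph_model :: "nat \<Rightarrow> real mat pmf \<Rightarrow> bool" where
  "graph_model n M \<longleftrightarrow> set_pmf M \<subseteq> adjacency_mats n"

definition model_volume :: "nat \<Rightarrow> real mat pmf \<Rightarrow> real" where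
  "model_volume n M = measure_pmf.expectation M (\<lambda>A. \<Sum>j<n. \<Sum>i<j. A $$ (i, j))"

text \<open>The product distribution \<open>pair_pmf M M\<close> is the law of two independent samples.
  The quotient is meaningful only if \<open>model_volume n M > 0\<close>.\<close>

definition model_overlap :: "nat \<Rightarrow> real mat pmf \<Rightarrow> real" where
  "model_overlap n M =
     measure_pmf.expectation (pair_pmf M M)
       (\<lambda>(A, A'). \<Sum>j<n. \<Sum>i<j. A $$ (i, j) * A' $$ (i, j)) / model_volume n M"

definition triangles :: "nat \<Rightarrow> real mat \<Rightarrow> nat set set" where
  "triangles n A = {T. T \<subseteq> {0..<n} \<and> card T = 3 \<and>
     (\<forall>u\<in>T. \<forall>v\<in>T. u \<noteq> v \<longrightarrow> A $$ (u, v) = 1)}"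

end

theory Submission
  imports Defs
begin

text \<open>Extending an edge by a third vertex reaches every triangle, so the expected number of
  triangles is at most \<open>n\<close> times the volume. The numerator of the overlap is the sum of the squared
  edge probabilities, and the volume is the sum of the edge probabilities. As there are at most
  \<open>n\<^sup>2 / 2\<close> potential edges, Cauchy-Schwarz bounds the overlap from below by \<open>2 / n\<^sup>2\<close> times
  the volume.\<close>

lemma adjacency_mats_entry:
  assumes "A \<in> adjacency_mats n" "i < n" "j < n"
  shows "A $$ (i, j) = 0 \<or> A $$ (i, j) = 1"
  using assms elements_matI[of A n n i j] by (auto simp: adjacency_mats_def)

text \<open>A 0/1 matrix is determined by the positions of its ones. Finiteness makes every real
  function integrable under a graph model and every expectation a finite sum.\<close>

lemma finite_adjacency_mats: "finite (adjacency_mats n)"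
proof (rule finite_subset)
  show "adjacency_mats n \<subseteq>
    (\<lambda>S. mat n n (\<lambda>p. if p \<in> S then 1 else 0)) ` Pow ({..<n} \<times> {..<n})"
  proof
    fix A assume A: "A \<in> adjacency_mats n"
    then have "A \<in> carrier_mat n n"
      by (simp add: adjacency_mats_def)
    then have "A = mat n n (\<lambda>p. if p \<in> {p \<in> {..<n} \<times> {..<n}. A $$ p = 1} then 1 else 0)"
      using adjacency_mats_entry[OF A] by (intro eq_matI) auto
    then show "A \<in> (\<lambda>S. mat n n (\<lambda>p. if p \<in> S then 1 else 0)) ` Pow ({..<n} \<times> {..<n})"
      by blast
  qed
qed simp

text \<open>Independence: over finite supports \<open>pmf (pair_pmf p q)\<close> factors pointwise,
  so the double sum splits.\<close>

lemma expectation_pair_pmf_mult: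
  fixes f g :: "_ \<Rightarrow> real"
  assumes "finite (set_pmf p)" "finite (set_pmf q)"
  shows "measure_pmf.expectation (pair_pmf p q) (\<lambda>x. f (fst x) * g (snd x)) =
    measure_pmf.expectation p f * measure_pmf.expectation q g"
proof -
  have "measure_pmf.expectation (pair_pmf p q) (\<lambda>x. f (fst x) * g (snd x)) =
      (\<Sum>x\<in>set_pmf p \<times> set_pmf q. f (fst x) * g (snd x) * pmf (pair_pmf p q) x)"
    using assms by (intro integral_measure_pmf_real) auto
  also have "\<dots> = (\<Sum>a\<in>set_pmf p. f a * pmf p a) * (\<Sum>b\<in>set_pmf q. g b * pmf q b)"
    unfolding sum_product sum.cartesian_product
    by (rule sum.cong) (auto simp: pmf_pair)
  also have "\<dots> = measure_pmf.expectation p f * measure_pmf.expectation q g"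
    using assms by (simp add: integral_measure_pmf_real[of "set_pmf p"]
        integral_measure_pmf_real[of "set_pmf q"])
  finally show ?thesis .
qed

text \<open>Any two of the three vertices, put in increasing order, serve as the edge. The third
  vertex \<open>k\<close> may lie anywhere relative to them, so one triangle can arise from several
  edges; an upper bound tolerates this.\<close>

lemma triangle_extends_edge:
  assumes "T \<in> triangles n A"
  obtains i j k where "T = {i, j, k}" "i < j" "j < n" "k < n" "A $$ (i, j) = 1"
proof -
  from assms have "card T = 3" by (simp add: triangles_def)
  then obtain x y z where T: "T = {x, y, z}" "x \<noteq> y" "y \<noteq> z" "x \<noteq> z"
    by (auto simp: card_3_iff)
  show thesis
  proof (cases "x < y")
    case True
    then show ?thesis using assms T by (intro that[of x y z]) (auto simp: triangles_def)
  next
    case False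
    then show ?thesis using assms T by (intro that[of y x z]) (auto simp: triangles_def)
  qed
qed

lemma card_triangles_le:
  assumes "A \<in> adjacency_mats n"
  shows "real (card (triangles n A)) \<le> real n * (\<Sum>j<n. \<Sum>i<j. A $$ (i, j))"
proof -
  \<comment> \<open>The larger endpoint comes first because the range of \<open>i\<close> depends on
    \<open>j\<close>, as in the nested sum.\<close>
  define E where "E = (SIGMA j:{..<n}. {i. i < j \<and> A $$ (i, j) = 1})"
  have fin: "finite E" by (simp add: E_def)
  have "triangles n A \<subseteq> (\<lambda>((j, i), k). {i, j, k}) ` (E \<times> {..<n})"
  proof
    fix T assume "T \<in> triangles n A"
    then obtain i j k where "T = {i, j, k}" "i < j" "j < n" "k < n" "A $$ (i, j) = 1"
      by (rule triangle_extends_edge)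
    then show "T \<in> (\<lambda>((j, i), k). {i, j, k}) ` (E \<times> {..<n})"
      by (intro image_eqI[of _ _ "((j, i), k)"]) (auto simp: E_def)
  qed
  then have "card (triangles n A) \<le> card (E \<times> {..<n})"
    using fin by (intro surj_card_le) auto
  then have "real (card (triangles n A)) \<le> real n * real (card E)"
    by (simp add: card_cartesian_product mult.commute flip: of_nat_mult)
  also have "real (card E) = (\<Sum>j<n. \<Sum>i<j. A $$ (i, j))"
  proof -
    have "real (card {i. i < j \<and> A $$ (i, j) = 1}) = (\<Sum>i<j. A $$ (i, j))" if "j < n" for j
    proof -
      have "(\<Sum>i<j. A $$ (i, j)) = (\<Sum>i<j. if A $$ (i, j) = 1 then 1 else 0)"
      proof (intro sum.cong refl)
        fix i assume "i \<in> {..<j}"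
        then show "A $$ (i, j) = (if A $$ (i, j) = 1 then 1 else 0)"
          using that adjacency_mats_entry[OF assms, of i j] by auto
      qed
      also have "\<dots> = real (card {i. i < j \<and> A $$ (i, j) = 1})"
        by (simp add: sum.If_cases Int_def)
      finally show ?thesis by simp
    qed
    then show ?thesis by (simp add: E_def)
  qed
  finally show ?thesis .
qed

theorem theorem2:
  fixes n :: nat and M :: "real mat pmf"
  assumes "graph_model n M"
    and "model_volume n M > 0"
  shows "measure_pmf.expectation M (\<lambda>A. real (card (triangles n A)))
           \<le> 1 / 2 * real n ^ 3 * model_overlap n M"
proof -
  \<comment> \<open>For a 0/1 entry the expectation is the probability of the edge.\<close>
  define p where "p = (\<lambda>(j, i). measure_pmf.expectation M (\<lambda>A. A $$ (i, j)))"
  define P :: "(nat \<times> nat) set" where "P = (SIGMA j:{..<n}. {..<j})"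
  define V where "V = model_volume n M"
  define S where "S = (\<Sum>e\<in>P. (p e)\<^sup>2)"
  have supp: "set_pmf M \<subseteq> adjacency_mats n"
    using assms(1) by (simp add: graph_model_def)
  then have fin: "finite (set_pmf M)"
    using finite_adjacency_mats finite_subset by blast
  have int: "integrable (measure_pmf M) f" for f :: "_ \<Rightarrow> real"
    using fin by (rule integrable_measure_pmf_finite)
  have int2: "integrable (measure_pmf (pair_pmf M M)) f" for f :: "_ \<Rightarrow> real"
    using fin by (intro integrable_measure_pmf_finite) simp
  have V_pos: "V > 0"
    using assms(2) by (simp add: V_def)
  have V_eq: "V = (\<Sum>e\<in>P. p e)"
    by (simp add: V_def P_def p_def model_volume_def int sum.Sigma case_prod_unfold)
  \<comment> \<open>By independence, both samples contain a given edge \<open>e\<close> with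
    probability \<open>p e * p e\<close>.\<close>
  have overlap: "model_overlap n M = S / V"
    by (simp add: model_overlap_def V_def S_def P_def p_def case_prod_unfold int2
        expectation_pair_pmf_mult[OF fin fin, of "\<lambda>A. A $$ _" "\<lambda>A. A $$ _"] power2_eq_square sum.Sigma)
  \<comment> \<open>The pointwise bound is known only for adjacency matrices, hence monotonicity
    almost everywhere, that is, on the support of \<open>M\<close>.\<close>
  have "measure_pmf.expectation M (\<lambda>A. real (card (triangles n A)))
      \<le> measure_pmf.expectation M (\<lambda>A. real n * (\<Sum>j<n. \<Sum>i<j. A $$ (i, j)))"
    using supp by (intro integral_mono_AE int) (auto simp: AE_measure_pmf_iff card_triangles_le)
  also have "\<dots> = real n * V"
    by (simp add: V_def model_volume_def)
  also have "\<dots> \<le> real n * (S * (real n)\<^sup>2 / 2 / V)"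
  proof -
    have "card P = (\<Sum>j<n. j)"
      by (simp add: P_def)
    \<comment> \<open>The exact value is n(n-1); rounding it up to n^2 yields the factor n^3 / 2 in
      the end.\<close>
    also have "2 * \<dots> \<le> n * n"
      by (induction n) auto
    finally have "real (2 * card P) \<le> real (n * n)"
      by (simp only: of_nat_le_iff)
    then have P: "real (card P) \<le> (real n)\<^sup>2 / 2"
      by (simp add: power2_eq_square)
    \<comment> \<open>Cauchy-Schwarz for \<open>p\<close> against the constant 1 on
      \<open>P\<close>.\<close>
    have "V\<^sup>2 \<le> S * real (card P)"
      unfolding V_eq S_def by (rule sum_squared_le_sum_of_squares)
    also have "\<dots> \<le> S * ((real n)\<^sup>2 / 2)"
      using P by (intro mult_left_mono) (simp_all add: S_def sum_nonneg)
    \<comment> \<open>Dividing by \<open>V > 0\<close> makes the overlap \<open>S / V\<close> appear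
      on the right.\<close>
    finally have "V \<le> S * (real n)\<^sup>2 / 2 / V"
      using V_pos by (simp add: pos_le_divide_eq power2_eq_square)
    then show ?thesis by (rule mult_left_mono) simp
  qed
  also have "\<dots> = 1 / 2 * real n ^ 3 * model_overlap n M"
    by (simp add: overlap power2_eq_square power3_eq_cube)
  finally show ?thesis .
qed

end
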